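(* Let $n\ge2$ and $1\le j\le n$ be integers and suppose $\mathbb{E}|X_{j:n}|<\infty$. Then the conditional expectation $\mathbb{E}(X_{j:n}\mid X_{1:1})$ uniquely determines the parent cumulative distribution function $F$. That is, if $F$ and $G$ are two cumulative distribution functions of absolutely continuous distributions with the same interval $(a,b)=\{0<F<1\}=\{0<G<1\}$ and densities strictly positive on $(a,b)$, if $X_{j:n}$ is integrable under both, and if the regression function $x\mapsto\mathbb{E}(X_{j:n}\mid X_{1:1}=x)$, $x\in(a,b)$, is the same (almost everywhere) under $F$ and under $G$, then $F=G$.
   Context: $X_1,X_2,\ldots$ are independent identically distributed real random variables with the parent cumulative distribution function, absolutely continuous with respect to Lebesgue measure, whose density is strictly positive on $(a,b)$, the set where the cumulative distribution function lies strictly between $0$ and $1$, $-\infty\le a<b\le\infty$. $X_{j:n}$ denotes the $j$-th smallest among $X_1,\ldots,X_n$, and $X_{1:1}=X_1$. *)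

theory Defs
  imports "HOL-Probability.Probability"
begin

text \<open>The sequence is indexed from 1; the value \<^term>\<open>X 0\<close> is irrelevant.\<close>

definition iid_with_cdf :: "'a measure \<Rightarrow> (nat \<Rightarrow> 'a \<Rightarrow> real) \<Rightarrow> (real \<Rightarrow> real) \<Rightarrow> bool" where
  "iid_with_cdf M X F \<longleftrightarrow>
     prob_space M \<and>
     prob_space.indep_vars M (\<lambda>_. borel) X {1..} \<and>
     (\<forall>i\<ge>1. cdf (distr M borel (X i)) = F)"

text \<open>A density is only determined up to null sets, so strict positivity is required of some version.\<close>

definition ac_cdf_on :: "ereal \<Rightarrow> ereal \<Rightarrow> (real \<Rightarrow> real) \<Rightarrow> bool" where
  "ac_cdf_on a b F \<longleftrightarrow>
     {x. 0 < F x \<and> F x < 1} = {x. a < ereal x \<and> ereal x < b} \<and>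
     (\<exists>f :: real \<Rightarrow> real.
        f \<in> borel_measurable borel \<and> (\<forall>x. 0 \<le> f x) \<and>
        (\<forall>x. a < ereal x \<and> ereal x < b \<longrightarrow> 0 < f x) \<and>
        prob_space (density lborel (\<lambda>x. ennreal (f x))) \<and>
        cdf (density lborel (\<lambda>x. ennreal (f x))) = F)"

text \<open>\<open>order_statistic X j n\<close> is \<open>X\<^bsub>j:n\<^esub>\<close>, the \<open>j\<close>-th smallest (counting from 1) of
  \<open>X 1, \<dots>, X n\<close>.  It is meaningful only for \<open>1 \<le> j \<le> n\<close>.\<close>

definition order_statistic :: "(nat \<Rightarrow> 'a \<Rightarrow> real) \<Rightarrow> nat \<Rightarrow> nat \<Rightarrow> 'a \<Rightarrow> real" where
  "order_statistic X j n \<omega> = sort (map (\<lambda>i. X i \<omega>) [1..<Suc n]) ! (j - 1)"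

lemma order_statistic_1_1: "order_statistic X 1 1 = X 1"
  by (simp add: order_statistic_def fun_eq_iff)

text \<open>\<open>regression_function M Z Y r\<close>: \<open>r\<close> is a version of the map \<open>x \<mapsto> E(Z | Y = x)\<close>, i.e.
  \<open>r \<circ> Y\<close> is a version of the conditional expectation of \<open>Z\<close> given the sigma-algebra
  generated by \<open>Y\<close>.\<close>

definition regression_function ::
    "'a measure \<Rightarrow> ('a \<Rightarrow> real) \<Rightarrow> ('a \<Rightarrow> real) \<Rightarrow> (real \<Rightarrow> real) \<Rightarrow> bool" where
  "regression_function M Z Y r \<longleftrightarrow>
     r \<in> borel_measurable borel \<and>
     (AE \<omega> in M. real_cond_exp M (vimage_algebra (space M) Y borel) Z \<omega> = r (Y \<omega>))"

end

theory Submission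
  imports Defs
begin

text \<open>The order statistic \<open>X\<^bsub>j:n\<^esub>\<close> moves with \<open>X 1\<close>, at unit speed, precisely while exactly
  \<open>j - 1\<close> of the other observations lie below \<open>X 1\<close>, and is locally constant in it otherwise.  Hence the regression function has derivative
  \<open>B (F x)\<close> with \<open>B u = (n - 1 choose (j - 1)) * u ^ (j - 1) * (1 - u) ^ (n - j)\<close>, and equal
  regressions give \<open>B (F x) = B (G x)\<close> on \<open>(a, b)\<close>.  Now \<open>B\<close> is strictly unimodal with mode
  \<open>p = (j - 1) / (n - 1)\<close>, so \<open>F x \<noteq> G x\<close> would force, say, \<open>F x < p < G x\<close>.  By continuity
  \<open>F y = p\<close> for some \<open>y > x\<close>; then \<open>B (G y) = B p\<close> is the strict maximum, so
  \<open>G y = p < G x\<close>, contradicting monotonicity.\<close>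

section \<open>Order statistics through counting\<close>

lemma sorted_nth_le_iff:
  fixes ys :: "'a::linorder list"
  assumes "sorted ys" and "k < length ys"
  shows "ys ! k \<le> t \<longleftrightarrow> k < length (filter (\<lambda>y. y \<le> t) ys)"
proof
  assume "ys ! k \<le> t"
  then have "{..k} \<subseteq> {i. i < length ys \<and> ys ! i \<le> t}"
    using assms by (auto intro: order_trans[OF sorted_nth_mono])
  then have "card {..k} \<le> card {i. i < length ys \<and> ys ! i \<le> t}"
    by (intro card_mono) auto
  then show "k < length (filter (\<lambda>y. y \<le> t) ys)"
    by (simp add: length_filter_conv_card)
next
  assume less: "k < length (filter (\<lambda>y. y \<le> t) ys)"
  show "ys ! k \<le> t"
  proof (rule ccontr)
    assume "\<not> ys ! k \<le> t"
    then have "{i. i < length ys \<and> ys ! i \<le> t} \<subseteq> {..<k}"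
      using sorted_nth_mono[OF assms(1), of k] by (auto simp: not_le) (meson leD leI le_less_trans)
    then have "card {i. i < length ys \<and> ys ! i \<le> t} \<le> card {..<k}"
      by (intro card_mono) auto
    with less show False
      by (simp add: length_filter_conv_card)
  qed
qed

text \<open>Counting replaces sorting: sorting permutes the sample and so keeps the number of
  entries at most \<open>t\<close>. Measurability and the dependence on the first observation are
  both derived from this form.\<close>

lemma order_statistic_le_iff:
  assumes "1 \<le> j" "j \<le> n"
  shows "order_statistic X j n \<omega> \<le> t \<longleftrightarrow> j \<le> card {i\<in>{1..n}. X i \<omega> \<le> t}"
proof -
  let ?xs = "map (\<lambda>i. X i \<omega>) [1..<Suc n]"
  have "order_statistic X j n \<omega> \<le> t \<longleftrightarrow> j - 1 < length (filter (\<lambda>y. y \<le> t) (sort ?xs))"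
    unfolding order_statistic_def using assms by (intro sorted_nth_le_iff) auto
  also have "length (filter (\<lambda>y. y \<le> t) (sort ?xs)) = length (filter (\<lambda>y. y \<le> t) ?xs)"
    by (metis mset_filter mset_sort size_mset)
  also have "\<dots> = length (filter (\<lambda>i. X i \<omega> \<le> t) [1..<Suc n])"
    by (simp add: filter_map o_def del: upt_Suc)
  also have "\<dots> = card (set (filter (\<lambda>i. X i \<omega> \<le> t) [1..<Suc n]))"
    by (rule distinct_card[symmetric]) simp
  also have "set (filter (\<lambda>i. X i \<omega> \<le> t) [1..<Suc n]) = {i\<in>{1..n}. X i \<omega> \<le> t}"
    by auto
  finally show ?thesis
    using assms by auto
qed

lemma measurable_card_Collect:
  assumes "finite I" and "\<And>i. i \<in> I \<Longrightarrow> Measurable.pred M (P i)"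
  shows "(\<lambda>\<omega>. card {i\<in>I. P i \<omega>}) \<in> measurable M (count_space UNIV)"
proof -
  have "(\<lambda>\<omega>. card {i\<in>I. P i \<omega>}) = (\<lambda>\<omega>. \<Sum>i\<in>I. if P i \<omega> then 1 else 0)"
    using assms(1) by (simp add: sum.If_cases Int_def conj_commute)
  also have "\<dots> \<in> measurable M (count_space UNIV)"
    using assms(2) by (intro measurable_sum_nat measurable_If) auto
  finally show ?thesis .
qed

lemma borel_measurable_order_statistic:
  assumes "1 \<le> j" "j \<le> n" and [measurable]: "\<And>i. i \<in> {1..n} \<Longrightarrow> X i \<in> borel_measurable M"
  shows "order_statistic X j n \<in> borel_measurable M"
proof (subst borel_measurable_iff_le, intro allI)
  fix t
  have [measurable]: "(\<lambda>\<omega>. card {i\<in>{1..n}. X i \<omega> \<le> t}) \<in> measurable M (count_space UNIV)"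
    by (intro measurable_card_Collect) auto
  show "{\<omega> \<in> space M. order_statistic X j n \<omega> \<le> t} \<in> sets M"
    using assms(1,2) by (simp add: order_statistic_le_iff)
qed

section \<open>Dependence of an order statistic on the first observation\<close>

text \<open>Freezing the first observation at \<open>z\<close> adds one to the number of other
  observations at most \<open>t\<close> if \<open>z \<le> t\<close>, and nothing otherwise. So
  \<open>t\<close> separates the two order statistics exactly when the others contribute
  \<open>j - 1\<close> and only \<open>x\<close>, not \<open>y\<close>, supplies the missing
  one.\<close>

lemma order_statistic_upd_level_set:
  assumes "1 \<le> j" "j \<le> n"
  shows "order_statistic (X(1 := \<lambda>_. x)) j n \<omega> \<le> t \<and> t < order_statistic (X(1 := \<lambda>_. y)) j n \<omega> \<longleftrightarrow>
    x \<le> t \<and> t < y \<and> card {i\<in>{2..n}. X i \<omega> \<le> t} = j - 1"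
proof -
  have "{i\<in>{1..n}. (X(1 := \<lambda>_. z)) i \<omega> \<le> t} =
      (if z \<le> t then insert 1 {i\<in>{2..n}. X i \<omega> \<le> t} else {i\<in>{2..n}. X i \<omega> \<le> t})" for z
    using assms by (auto simp: Suc_le_eq numeral_2_eq_2 le_Suc_eq split: if_splits)
  then have "card {i\<in>{1..n}. (X(1 := \<lambda>_. z)) i \<omega> \<le> t} =
      card {i\<in>{2..n}. X i \<omega> \<le> t} + (if z \<le> t then 1 else 0)" for z
    by simp
  then show ?thesis
    unfolding order_statistic_le_iff[OF assms] not_le[symmetric] using assms by auto
qed

lemma order_statistic_upd_mono:
  assumes "1 \<le> j" "j \<le> n" "x \<le> y"
  shows "order_statistic (X(1 := \<lambda>_. x)) j n \<omega> \<le> order_statistic (X(1 := \<lambda>_. y)) j n \<omega>"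
proof (rule ccontr)
  assume "\<not> ?thesis"
  then show False
    \<comment> \<open>With the roles of \<open>x\<close> and \<open>y\<close> exchanged, the level
      \<open>t\<close> chosen here would satisfy \<open>y \<le> t\<close> and
      \<open>t < x\<close>.\<close>
    using order_statistic_upd_level_set[OF assms(1,2), of X y \<omega>
      "order_statistic (X(1 := \<lambda>_. y)) j n \<omega>" x] assms(3) by simp
qed

text \<open>The levels separating the two order statistics form a half-open interval contained in
  \<open>{x..<y}\<close>; comparing lengths gives the bound. It later carries integrability from one
  frozen value to all others.\<close>

lemma order_statistic_upd_lipschitz:
  assumes "1 \<le> j" "j \<le> n"
  shows "\<bar>order_statistic (X(1 := \<lambda>_. x)) j n \<omega> - order_statistic (X(1 := \<lambda>_. y)) j n \<omega>\<bar> \<le> \<bar>x - y\<bar>"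
proof -
  have up: "order_statistic (X(1 := \<lambda>_. y)) j n \<omega> - order_statistic (X(1 := \<lambda>_. x)) j n \<omega> \<le> y - x"
    if "x \<le> y" for x y
  proof -
    let ?hx = "order_statistic (X(1 := \<lambda>_. x)) j n \<omega>" and ?hy = "order_statistic (X(1 := \<lambda>_. y)) j n \<omega>"
    have "{?hx..<?hy} \<subseteq> {x..<y}"
      using order_statistic_upd_level_set[OF assms] by fastforce
    then have "emeasure lborel {?hx..<?hy} \<le> emeasure lborel {x..<y}"
      by (rule emeasure_mono) simp
    then show ?thesis
      using order_statistic_upd_mono[OF assms that, of X \<omega>] that by simp
  qed
  show ?thesis
    using up[of x y] up[of y x] order_statistic_upd_mono[OF assms, of x y X \<omega>]
      order_statistic_upd_mono[OF assms, of y x X \<omega>] by linarith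
qed

section \<open>Conditioning a function of two independent variables on one of them\<close>

text \<open>Restricting the family to \<open>{i}\<close> and to \<open>I\<close> gives two
  independent tuples; evaluating the first, which has a single entry, at \<open>i\<close> pushes the
  product law forward to the one wanted.\<close>

lemma (in prob_space) distr_pair_indep_vars_insert:
  assumes indep: "indep_vars M' X (insert i I)" and "i \<notin> I"
  shows "distr M (M' i) (X i) \<Otimes>\<^sub>M distr M (PiM I M') (\<lambda>\<omega>. \<lambda>k\<in>I. X k \<omega>) =
    distr M (M' i \<Otimes>\<^sub>M PiM I M') (\<lambda>\<omega>. (X i \<omega>, \<lambda>k\<in>I. X k \<omega>))"
proof -
  let ?U = "\<lambda>\<omega>. \<lambda>k\<in>{i}. X k \<omega>" and ?W = "\<lambda>\<omega>. \<lambda>k\<in>I. X k \<omega>"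
  let ?D = "distr M (PiM {i} M') ?U" and ?Q = "distr M (PiM I M') ?W"
  have "indep_var (PiM {i} M') ?U (PiM I M') ?W"
    using assms by (intro indep_var_restrict[OF indep]) auto
  then have U[measurable]: "?U \<in> measurable M (PiM {i} M')" and W[measurable]: "?W \<in> measurable M (PiM I M')"
    and joint: "?D \<Otimes>\<^sub>M ?Q = distr M (PiM {i} M' \<Otimes>\<^sub>M PiM I M') (\<lambda>\<omega>. (?U \<omega>, ?W \<omega>))"
    unfolding indep_var_distribution_eq by auto
  interpret Q: prob_space ?Q by (rule prob_space_distr) fact
  have X_eq: "distr M (M' i) (X i) = distr ?D (M' i) (\<lambda>v. v i)"
    by (subst distr_distr) (auto simp: o_def)
  \<comment> \<open>\<open>pair_measure_distr\<close> pushes both factors forward, so the second one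
    is written as its own image under the identity.\<close>
  have Q_eq: "?Q = distr ?Q (PiM I M') (\<lambda>w. w)"
    by (simp add: distr_distr o_def)
  have "distr M (M' i) (X i) \<Otimes>\<^sub>M ?Q =
      distr (?D \<Otimes>\<^sub>M ?Q) (M' i \<Otimes>\<^sub>M PiM I M') (\<lambda>(v, w). (v i, w))"
    unfolding X_eq by (subst (1) Q_eq, rule pair_measure_distr)
      (auto simp: Q_eq[symmetric] intro: Q.sigma_finite_measure_axioms)
  also have "\<dots> = distr M (M' i \<Otimes>\<^sub>M PiM I M') (\<lambda>\<omega>. (X i \<omega>, ?W \<omega>))"
    unfolding joint by (subst distr_distr) (auto simp: o_def)
  finally show ?thesis .
qed

lemma (in prob_space)
  fixes U :: "'a \<Rightarrow> real" and W :: "'a \<Rightarrow> 'b" and g :: "real \<times> 'b \<Rightarrow> real"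
  assumes U[measurable]: "U \<in> borel_measurable M" and W[measurable]: "W \<in> measurable M S"
    and indep: "distr M borel U \<Otimes>\<^sub>M distr M S W = distr M (borel \<Otimes>\<^sub>M S) (\<lambda>\<omega>. (U \<omega>, W \<omega>))"
    and [measurable]: "g \<in> borel_measurable (borel \<Otimes>\<^sub>M S)"
    and int: "integrable M (\<lambda>\<omega>. g (U \<omega>, W \<omega>))"
  shows AE_integrable_indep: "AE x in distr M borel U. integrable M (\<lambda>\<omega>. g (x, W \<omega>))"
    and real_cond_exp_indep:
      "AE \<omega> in M. real_cond_exp M (vimage_algebra (space M) U borel) (\<lambda>\<omega>. g (U \<omega>, W \<omega>)) \<omega> =
        (\<integral>\<omega>'. g (U \<omega>, W \<omega>') \<partial>M)"
    and borel_measurable_integral_indep: "(\<lambda>x. \<integral>\<omega>. g (x, W \<omega>) \<partial>M) \<in> borel_measurable borel"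
proof -
  define D where "D = distr M borel U"
  define Q where "Q = distr M S W"
  define R where "R x = (\<integral>w. g (x, w) \<partial>Q)" for x
  have [measurable_cong, simp]: "sets D = sets borel" "sets Q = sets S"
    by (auto simp: D_def Q_def)
  interpret D: prob_space D unfolding D_def by (rule prob_space_distr) simp
  interpret Q: prob_space Q unfolding Q_def by (rule prob_space_distr) simp
  interpret DQ: pair_prob_space D Q ..
  have joint: "D \<Otimes>\<^sub>M Q = distr M (borel \<Otimes>\<^sub>M S) (\<lambda>\<omega>. (U \<omega>, W \<omega>))"
    using indep unfolding D_def Q_def .
  have R_eq: "(\<integral>\<omega>. g (x, W \<omega>) \<partial>M) = R x" for x
    unfolding R_def Q_def by (rule integral_distr[symmetric]) auto
  have int_g: "integrable (D \<Otimes>\<^sub>M Q) g"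
    unfolding joint by (subst integrable_distr_eq) (use int in auto)
  have "AE x in D. integrable Q (\<lambda>w. g (x, w))"
    using DQ.AE_integrable_fst'[OF int_g] .
  then show "AE x in distr M borel U. integrable M (\<lambda>\<omega>. g (x, W \<omega>))"
    unfolding D_def[symmetric] by eventually_elim (auto simp: Q_def integrable_distr_eq)
  have [measurable]: "R \<in> borel_measurable borel"
    unfolding R_def by measurable
  then show "(\<lambda>x. \<integral>\<omega>. g (x, W \<omega>) \<partial>M) \<in> borel_measurable borel"
    unfolding R_eq .
  have "integrable D R"
    using DQ.integrable_fst'[OF int_g] unfolding R_def .
  then have int_R: "integrable M (\<lambda>\<omega>. R (U \<omega>))"
    unfolding D_def by (subst (asm) integrable_distr_eq) auto
  let ?V = "vimage_algebra (space M) U borel"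
  interpret V: finite_measure_subalgebra M ?V
    by unfold_locales (auto simp: subalgebra_def sets_vimage_algebra2 intro!: measurable_sets)
  have "AE \<omega> in M. real_cond_exp M ?V (\<lambda>\<omega>. g (U \<omega>, W \<omega>)) \<omega> = R (U \<omega>)"
  proof (rule V.real_cond_exp_charact)
    fix A assume "A \<in> sets ?V"
    \<comment> \<open>Every event generated by \<open>U\<close> has this form, so the defining
      identity of the conditional expectation is Fubini for \<open>g\<close> times the indicator of
      \<open>B\<close> in the first coordinate.\<close>
    then obtain B where [measurable]: "B \<in> sets borel" and A: "A = U -` B \<inter> space M"
      by (auto simp: sets_vimage_algebra2)
    have "(\<integral>\<omega>\<in>A. g (U \<omega>, W \<omega>) \<partial>M) = (\<integral>\<omega>. (\<lambda>(x, w). indicator B x * g (x, w)) (U \<omega>, W \<omega>) \<partial>M)"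
      unfolding set_lebesgue_integral_def A by (intro Bochner_Integration.integral_cong) (auto simp: indicator_def)
    also have "\<dots> = (\<integral>z. (\<lambda>(x, w). indicator B x * g (x, w)) z \<partial>(D \<Otimes>\<^sub>M Q))"
      unfolding joint by (rule integral_distr[symmetric]) auto
    also have "\<dots> = (\<integral>x. (\<integral>w. (\<lambda>(x, w). indicator B x * g (x, w)) (x, w) \<partial>Q) \<partial>D)"
    proof (rule DQ.integral_fst'[symmetric])
      show "integrable (D \<Otimes>\<^sub>M Q) (\<lambda>(x, w). indicator B x * g (x, w))"
        by (rule Bochner_Integration.integrable_bound[OF int_g]) (auto simp: indicator_def)
    qed
    also have "\<dots> = (\<integral>x. indicator B x * R x \<partial>D)"
      by (simp add: R_def)
    also have "\<dots> = (\<integral>\<omega>. indicator B (U \<omega>) * R (U \<omega>) \<partial>M)"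
      unfolding D_def by (rule integral_distr) auto
    also have "\<dots> = (\<integral>\<omega>\<in>A. R (U \<omega>) \<partial>M)"
      unfolding set_lebesgue_integral_def A by (intro Bochner_Integration.integral_cong) (auto simp: indicator_def)
    finally show "(\<integral>\<omega>\<in>A. g (U \<omega>, W \<omega>) \<partial>M) = (\<integral>\<omega>\<in>A. R (U \<omega>) \<partial>M)" .
  next
    show "(\<lambda>\<omega>. R (U \<omega>)) \<in> borel_measurable ?V"
      by (rule measurable_compose[OF measurable_vimage_algebra1]) auto
  qed (use int int_R in auto)
  then show "AE \<omega> in M. real_cond_exp M ?V (\<lambda>\<omega>. g (U \<omega>, W \<omega>)) \<omega> = (\<integral>\<omega>'. g (U \<omega>, W \<omega>') \<partial>M)"
    unfolding R_eq .
qed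

section \<open>Strict unimodality of \<open>u ^ k * (1 - u) ^ l\<close>\<close>

text \<open>The derivative has the sign of \<open>k - (k + l) * x\<close>, which is positive left of
  the mode \<open>k / (k + l)\<close>. It may vanish at \<open>u = 0\<close> or when
  \<open>v\<close> is the mode, hence the criterion that looks only at the open interval.\<close>

lemma power_mult_power_strict_increasing:
  fixes u v :: real
  assumes "0 < k" "0 \<le> u" "u < v" "v \<le> 1" and mode: "real (k + l) * v \<le> real k"
  shows "u ^ k * (1 - u) ^ l < v ^ k * (1 - v) ^ l"
proof (rule DERIV_pos_imp_increasing_open[OF \<open>u < v\<close>])
  fix x assume x: "u < x" "x < v"
  obtain k' where k': "k = Suc k'" using assms(1) by (cases k) auto
  have "real (k + l) * x < real (k + l) * v"
    using x assms(1) by simp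
  then have pos: "real k - real (k + l) * x > 0"
    using mode by simp
  have "((\<lambda>x. x ^ k * (1 - x) ^ l) has_real_derivative
      x ^ k * (real l * (1 - x) ^ (l - 1) * (- 1)) + real k * x ^ (k - 1) * (1 - x) ^ l) (at x)"
    by (auto intro!: derivative_eq_intros)
  \<comment> \<open>For \<open>l = 0\<close> the truncated exponent \<open>l - 1\<close> is 0 and
    the factored form would be wrong, so this case is kept apart.\<close>
  also have "x ^ k * (real l * (1 - x) ^ (l - 1) * (- 1)) + real k * x ^ (k - 1) * (1 - x) ^ l =
      (if l = 0 then real k * x ^ (k - 1) else x ^ (k - 1) * (1 - x) ^ (l - 1) * (real k - real (k + l) * x))"
    by (cases l) (auto simp: k' algebra_simps)
  finally show "\<exists>y. ((\<lambda>x. x ^ k * (1 - x) ^ l) has_real_derivative y) (at x) \<and> 0 < y"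
    using x assms pos by (intro exI conjI) auto
qed (auto intro!: continuous_intros)

text \<open>The reflection of \<open>u\<close> to \<open>1 - u\<close> exchanges \<open>k\<close>
  and \<open>l\<close> and reverses the order.\<close>

lemma power_mult_power_strict_decreasing:
  fixes u v :: real
  assumes "0 < l" "0 \<le> u" "u < v" "v \<le> 1" and mode: "real k \<le> real (k + l) * u"
  shows "v ^ k * (1 - v) ^ l < u ^ k * (1 - u) ^ l"
  using power_mult_power_strict_increasing[of l "1 - v" "1 - u" k] assms
  by (simp add: algebra_simps)

lemma (in prob_space) prob_card_le_eq_binomial:
  fixes X :: "'i \<Rightarrow> 'a \<Rightarrow> real"
  assumes indep: "indep_vars (\<lambda>_. borel) X I" and I: "finite I" "I \<noteq> {}"
    and cdf_X: "\<And>i. i \<in> I \<Longrightarrow> cdf (distr M borel (X i)) t = p"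
  shows "prob {\<omega>\<in>space M. card {i\<in>I. X i \<omega> \<le> t} = k} =
    real (card I choose k) * p ^ k * (1 - p) ^ (card I - k)"
proof -
  \<comment> \<open>\<open>A S\<close> is the event that \<open>S\<close> is exactly the set of
    indices with observation at most \<open>t\<close>, written as an intersection over
    \<open>I\<close> so that independence factors its probability. Over an empty \<open>I\<close>
    the intersection would be \<open>UNIV\<close> instead of \<open>space M\<close>, which
    \<open>I \<noteq> {}\<close> excludes.\<close>
  define A where "A S = (\<Inter>i\<in>I. X i -` (if i \<in> S then {..t} else {t<..}) \<inter> space M)" for S
  have X[measurable]: "X i \<in> borel_measurable M" if "i \<in> I" for i
    using indep that by (auto simp: indep_vars_def)
  have A_iff: "\<omega> \<in> A S \<longleftrightarrow> \<omega> \<in> space M \<and> {i\<in>I. X i \<omega> \<le> t} = S" if "S \<subseteq> I" for S \<omega>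
  proof -
    have "\<omega> \<in> X i -` (if i \<in> S then {..t} else {t<..}) \<inter> space M \<longleftrightarrow>
        \<omega> \<in> space M \<and> (X i \<omega> \<le> t \<longleftrightarrow> i \<in> S)" for i
      by auto
    then have "\<omega> \<in> A S \<longleftrightarrow> (\<forall>i\<in>I. \<omega> \<in> space M \<and> (X i \<omega> \<le> t \<longleftrightarrow> i \<in> S))"
      unfolding A_def INT_iff by (intro ball_cong refl)
    also have "\<dots> \<longleftrightarrow> \<omega> \<in> space M \<and> {i\<in>I. X i \<omega> \<le> t} = S"
      using I(2) that by blast
    finally show ?thesis .
  qed
  have A_sets: "A S \<in> events" for S
    unfolding A_def using I by (intro sets.finite_INT measurable_sets[OF X]) auto
  have le: "prob (X i -` {..t} \<inter> space M) = p" if "i \<in> I" for i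
    using that cdf_X[OF that] by (simp add: cdf_def measure_distr)
  have gt: "prob (X i -` {t<..} \<inter> space M) = 1 - p" if "i \<in> I" for i
  proof -
    have "X i -` {t<..} \<inter> space M = space M - (X i -` {..t} \<inter> space M)"
      by auto
    then show ?thesis
      using prob_compl[OF measurable_sets[OF X[OF that], of "{..t}"]] le[OF that] by simp
  qed
  have prob_A: "prob (A S) = p ^ card S * (1 - p) ^ (card I - card S)" if S: "S \<subseteq> I" for S
  proof -
    have "prob (A S) = (\<Prod>i\<in>I. prob (X i -` (if i \<in> S then {..t} else {t<..}) \<inter> space M))"
      unfolding A_def using I by (intro indep_varsD_finite[OF indep]) auto
    also have "\<dots> = (\<Prod>i\<in>I. if i \<in> S then p else 1 - p)"
      by (intro prod.cong) (auto simp: le gt)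
    also have "\<dots> = p ^ card S * (1 - p) ^ card (I - S)"
      using I(1) S by (simp add: prod.If_cases Int_absorb1 Diff_eq)
    finally show ?thesis
      using I(1) S by (simp add: card_Diff_subset finite_subset)
  qed
  have "{\<omega>\<in>space M. card {i\<in>I. X i \<omega> \<le> t} = k} = (\<Union>S\<in>{S. S \<subseteq> I \<and> card S = k}. A S)"
    by (auto simp: A_iff)
  also have "prob \<dots> = (\<Sum>S\<in>{S. S \<subseteq> I \<and> card S = k}. prob (A S))"
  proof (rule finite_measure_finite_Union)
    show "disjoint_family_on A {S. S \<subseteq> I \<and> card S = k}"
      unfolding disjoint_family_on_def by (metis (no_types, lifting) A_iff disjoint_iff mem_Collect_eq)
  qed (use I(1) A_sets in auto)
  also have "\<dots> = (\<Sum>S\<in>{S. S \<subseteq> I \<and> card S = k}. p ^ k * (1 - p) ^ (card I - k))"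
    by (intro sum.cong) (auto simp: prob_A)
  finally show ?thesis
    using I(1) by (simp add: n_subsets)
qed

text \<open>The increment of the order statistic between two frozen values is the length of the set
  of levels separating them. By Tonelli its expectation integrates, over those levels, the binomial
  probability that \<open>j - 1\<close> of the other \<open>n - 1\<close> observations lie at or
  below the level; the fundamental theorem of calculus then applies.\<close>

lemma (in prob_space) has_real_derivative_expectation_order_statistic_upd:
  fixes X :: "nat \<Rightarrow> 'a \<Rightarrow> real"
  assumes j: "1 \<le> j" "j \<le> n" and n: "2 \<le> n"
    and indep: "indep_vars (\<lambda>_. borel) X {2..n}"
    and cdf_X: "\<And>i. i \<in> {2..n} \<Longrightarrow> cdf (distr M borel (X i)) = F"
    and cont: "\<And>t. isCont F t"
    and int: "integrable M (order_statistic (X(1 := \<lambda>_. x0)) j n)"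
  shows "((\<lambda>x. expectation (order_statistic (X(1 := \<lambda>_. x)) j n)) has_real_derivative
      real (n - 1 choose (j - 1)) * (F z ^ (j - 1) * (1 - F z) ^ (n - j))) (at z)"
proof -
  define H where "H x = order_statistic (X(1 := \<lambda>_. x)) j n" for x
  define b where "b t = real (n - 1 choose (j - 1)) * (F t ^ (j - 1) * (1 - F t) ^ (n - j))" for t
  interpret pair: pair_sigma_finite M lborel ..
  have X[measurable]: "X i \<in> borel_measurable M" if "i \<in> {2..n}" for i
    using indep that by (auto simp: indep_vars_def)
  have H_meas[measurable]: "H x \<in> borel_measurable M" for x
    unfolding H_def using j by (intro borel_measurable_order_statistic) auto
  have b_prob: "prob {\<omega>\<in>space M. card {i\<in>{2..n}. X i \<omega> \<le> t} = j - 1} = b t" for t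
    using n j prob_card_le_eq_binomial[OF indep _ _, of t "F t" "j - 1"] cdf_X
    by (simp add: b_def)
  have H_mono: "H x \<omega> \<le> H y \<omega>" if "x \<le> y" for x y \<omega>
    unfolding H_def by (rule order_statistic_upd_mono[OF j that])
  have H_lip: "\<bar>H x \<omega> - H y \<omega>\<bar> \<le> \<bar>x - y\<bar>" for x y \<omega>
    unfolding H_def by (rule order_statistic_upd_lipschitz[OF j])
  have H_int: "integrable M (H x)" for x
  proof (rule Bochner_Integration.integrable_bound)
    show "integrable M (\<lambda>\<omega>. \<bar>H x0 \<omega>\<bar> + \<bar>x - x0\<bar>)"
      using int by (auto simp: H_def)
    show "AE \<omega> in M. norm (H x \<omega>) \<le> norm (\<bar>H x0 \<omega>\<bar> + \<bar>x - x0\<bar>)"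
    proof (rule AE_I2)
      fix \<omega>
      show "norm (H x \<omega>) \<le> norm (\<bar>H x0 \<omega>\<bar> + \<bar>x - x0\<bar>)"
        using H_lip[of x \<omega> x0] by simp
    qed
  qed simp
  have b_nonneg: "0 \<le> b t" for t
    unfolding b_prob[symmetric] by (rule measure_nonneg)
  have b_cont: "continuous_on S b" for S
    unfolding b_def using cont by (intro continuous_intros) (auto simp: continuous_at_imp_continuous_on)
  have b_meas[measurable]: "b \<in> borel_measurable borel"
    by (rule borel_measurable_continuous_onI[OF b_cont])
  have diff: "expectation (H y) - expectation (H x) = integral {x..y} b" if xy: "x \<le> y" for x y
  proof -
    have level: "indicator {H x \<omega>..<H y \<omega>} t =
        (indicator {x..<y} t * indicator {\<omega>\<in>space M. card {i\<in>{2..n}. X i \<omega> \<le> t} = j - 1} \<omega> :: ennreal)"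
      if "\<omega> \<in> space M" for \<omega> t
      using order_statistic_upd_level_set[OF j, of X x \<omega> t y, folded H_def] that
      unfolding indicator_def by simp
    have card_meas: "{\<omega>\<in>space M. card {i\<in>{2..n}. X i \<omega> \<le> t} = j - 1} \<in> events" for t
    proof -
      have [measurable]: "(\<lambda>\<omega>. card {i\<in>{2..n}. X i \<omega> \<le> t}) \<in> measurable M (count_space UNIV)"
        by (intro measurable_card_Collect) auto
      show ?thesis by measurable
    qed
    have "ennreal (expectation (H y) - expectation (H x)) = ennreal (expectation (\<lambda>\<omega>. H y \<omega> - H x \<omega>))"
      using H_int by simp
    also have "\<dots> = (\<integral>\<^sup>+\<omega>. ennreal (H y \<omega> - H x \<omega>) \<partial>M)"
      using H_int H_mono[OF xy] by (intro nn_integral_eq_integral[symmetric]) auto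
    \<comment> \<open>The increment becomes the Lebesgue measure of an interval of levels, which
      makes the order of integration exchangeable.\<close>
    also have "\<dots> = (\<integral>\<^sup>+\<omega>. \<integral>\<^sup>+t. indicator {H x \<omega>..<H y \<omega>} t \<partial>lborel \<partial>M)"
      using H_mono[OF xy] by simp
    also have "\<dots> = (\<integral>\<^sup>+t. \<integral>\<^sup>+\<omega>. indicator {H x \<omega>..<H y \<omega>} t \<partial>M \<partial>lborel)"
    proof -
      have "(\<lambda>(\<omega>, t). indicator {H x \<omega>..<H y \<omega>} t :: ennreal) \<in> borel_measurable (M \<Otimes>\<^sub>M lborel)"
        unfolding indicator_def atLeastLessThan_iff case_prod_beta by measurable
      from pair.Fubini[OF this] show ?thesis by simp
    qed
    also have "\<dots> = (\<integral>\<^sup>+t. indicator {x..<y} t * ennreal (b t) \<partial>lborel)"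
    proof (rule nn_integral_cong)
      fix t
      have "(\<integral>\<^sup>+\<omega>. indicator {H x \<omega>..<H y \<omega>} t \<partial>M) =
          (\<integral>\<^sup>+\<omega>. indicator {x..<y} t * indicator {\<omega>\<in>space M. card {i\<in>{2..n}. X i \<omega> \<le> t} = j - 1} \<omega> \<partial>M)"
        by (intro nn_integral_cong level)
      also have "\<dots> = indicator {x..<y} t * ennreal (b t)"
        by (subst nn_integral_cmult) (use card_meas[of t] b_prob[of t] in \<open>auto simp: emeasure_eq_measure\<close>)
      finally show "(\<integral>\<^sup>+\<omega>. indicator {H x \<omega>..<H y \<omega>} t \<partial>M) = indicator {x..<y} t * ennreal (b t)" .
    qed
    also have "\<dots> = (\<integral>\<^sup>+t. indicator {x..y} t * ennreal (b t) \<partial>lborel)"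
      \<comment> \<open>The intervals differ only in the null set \<open>{y}\<close>; the closed one
        suits the gauge integral.\<close>
      using AE_lborel_singleton[of y] by (intro nn_integral_cong_AE) (auto simp: indicator_def)
    also have "\<dots> = (\<integral>\<^sup>+t. ennreal (indicator {x..y} t * b t) \<partial>lborel)"
      by (intro nn_integral_cong) (auto simp: indicator_def)
    also have "\<dots> = ennreal (integral {x..y} b)"
      using b_nonneg integrable_continuous_interval[OF b_cont]
      by (intro nn_integral_has_integral_lebesgue) auto
    finally have eq: "ennreal (expectation (H y) - expectation (H x)) = ennreal (integral {x..y} b)" .
    \<comment> \<open>\<open>ennreal\<close> sends negative reals to 0, so the equality can be
      pulled back to the reals only once both sides are known to be nonnegative.\<close>
    have "expectation (H x) \<le> expectation (H y)"
      by (intro integral_mono H_int H_mono[OF xy])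
    moreover have "0 \<le> integral {x..y} b"
      using b_nonneg by (intro integral_nonneg integrable_continuous_interval[OF b_cont]) auto
    ultimately show ?thesis
      using eq by (simp del: Bochner_Integration.integral_diff)
  qed
  \<comment> \<open>The base point \<open>z - 1\<close> and the right end \<open>z + 1\<close> put
    \<open>z\<close> in the interior, so the derivative within the interval is a full
    derivative.\<close>
  have "((\<lambda>x. integral {z - 1..x} b) has_real_derivative b z) (at z within {z - 1..z + 1})"
    using b_cont by (intro integral_has_real_derivative) auto
  then have "((\<lambda>x. expectation (H (z - 1)) + integral {z - 1..x} b) has_real_derivative b z) (at z)"
    by (simp add: at_within_Icc_at DERIV_cmult DERIV_add[OF DERIV_const, simplified])
  then show ?thesis
    unfolding H_def[symmetric] b_def[symmetric]
  proof (rule has_field_derivative_transform_within[where d = 1])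
    fix x :: real assume "dist x z < 1"
    then have "z - 1 \<le> x"
      by (simp add: dist_real_def)
    then show "expectation (H (z - 1)) + integral {z - 1..x} b = expectation (H x)"
      using diff[of "z - 1" x] by simp
  qed auto
qed

text \<open>The two families may live on different sample spaces; this lets an order statistic on a
  product space be compared with the one of \<open>X\<close>.\<close>

lemma order_statistic_cong:
  assumes "\<And>i. i \<in> {1..n} \<Longrightarrow> X i \<omega> = Y i \<omega>'"
  shows "order_statistic X j n \<omega> = order_statistic Y j n \<omega>'"
proof -
  have "map (\<lambda>i. X i \<omega>) [1..<Suc n] = map (\<lambda>i. Y i \<omega>') [1..<Suc n]"
    using assms by (intro map_cong) auto
  then show ?thesis
    by (simp only: order_statistic_def)
qed

section \<open>Injectivity off the mode, almost everywhere equality, continuity of the distribution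
  functions\<close>

text \<open>\<open>side\<close> puts both points on the same side of the mode, where the function is
  strictly monotone. If \<open>k\<close> or \<open>l\<close> is 0, the mode is an endpoint of
  \<open>[0, 1]\<close>, and two distinct points can share only the other side.\<close>

lemma power_mult_power_inj:
  fixes u v :: real
  assumes eq: "u ^ k * (1 - u) ^ l = v ^ k * (1 - v) ^ l"
    and uv: "0 \<le> u" "u \<le> 1" "0 \<le> v" "v \<le> 1" and "0 < k + l"
    and side: "real (k + l) * u \<le> k \<and> real (k + l) * v \<le> k \<or> k \<le> real (k + l) * u \<and> k \<le> real (k + l) * v"
  shows "u = v"
proof -
  have neq: "u ^ k * (1 - u) ^ l \<noteq> v ^ k * (1 - v) ^ l"
    if "0 \<le> u" "u < v" "v \<le> 1" and "real (k + l) * v \<le> k \<or> k \<le> real (k + l) * u" for u v :: real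
    using that(4)
  proof
    assume le: "real (k + l) * v \<le> k"
    moreover have "0 < real (k + l) * v"
      using that \<open>0 < k + l\<close> by (intro mult_pos_pos) auto
    ultimately have "0 < k"
      by simp
    with that le show ?thesis
      using power_mult_power_strict_increasing[of k u v l] by simp
  next
    assume ge: "k \<le> real (k + l) * u"
    moreover have "real (k + l) * u < real (k + l) * 1"
      using that \<open>0 < k + l\<close> by (intro mult_strict_left_mono) auto
    ultimately have "0 < l"
      by simp
    with that ge show ?thesis
      using power_mult_power_strict_decreasing[of l u v k] by simp
  qed
  show ?thesis
    using neq[of u v] neq[of v u] eq uv side by (cases u v rule: linorder_cases) auto
qed

text \<open>The set where the functions differ is open and null, hence empty. This turns regressions
  equal almost everywhere into functions equal everywhere, whose derivatives can be
  compared.\<close>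

lemma continuous_on_AE_lborel_eq:
  fixes f g :: "'a::euclidean_space \<Rightarrow> real"
  assumes "open S" "continuous_on S f" "continuous_on S g"
    and ae: "AE x in lborel. x \<in> S \<longrightarrow> f x = g x" and "x \<in> S"
  shows "f x = g x"
proof -
  define T where "T = S \<inter> (\<lambda>x. f x - g x) -` (- {0})"
  have "open T"
    unfolding T_def using assms by (intro continuous_open_preimage continuous_intros) auto
  moreover have "T \<in> null_sets lborel"
  proof (subst AE_iff_null_sets)
    show "T \<in> sets lborel"
      using \<open>open T\<close> by simp
    show "AE x in lborel. x \<notin> T"
      using ae by eventually_elim (auto simp: T_def)
  qed
  then have "negligible T"
    unfolding negligible_iff_null_sets by (rule null_sets_completionI)
  ultimately have "T = {}"
    using open_not_negligible by blast
  with \<open>x \<in> S\<close> show ?thesis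
    by (auto simp: T_def)
qed

lemma real_distribution_densityI:
  "f \<in> borel_measurable borel \<Longrightarrow> prob_space (density lborel (\<lambda>x. ennreal (f x))) \<Longrightarrow>
    real_distribution (density lborel (\<lambda>x. ennreal (f x)))"
  by (simp add: real_distribution_def real_distribution_axioms_def)

lemma ac_cdf_onD:
  assumes "ac_cdf_on a b F"
  shows "isCont F t" "mono F" "0 \<le> F t" "F t \<le> 1" "(F \<longlongrightarrow> 1) at_top"
    "0 < F t \<and> F t < 1 \<longleftrightarrow> a < ereal t \<and> ereal t < b"
proof -
  obtain f :: "real \<Rightarrow> real" where [measurable]: "f \<in> borel_measurable borel"
    and D: "prob_space (density lborel (\<lambda>x. ennreal (f x)))"
    and F: "cdf (density lborel (\<lambda>x. ennreal (f x))) = F"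
    using assms unfolding ac_cdf_on_def by blast
  interpret real_distribution "density lborel (\<lambda>x. ennreal (f x))"
    by (rule real_distribution_densityI) fact+
  \<comment> \<open>A measure with a Lebesgue density has no atoms, and a jump of the cdf at
    \<open>t\<close> would be the mass of \<open>{t}\<close>.\<close>
  have "AE x in lborel. x \<in> {t} \<longrightarrow> ennreal (f x) = 0"
    using AE_lborel_singleton[of t] by eventually_elim auto
  then have "{t} \<in> null_sets (density lborel (\<lambda>x. ennreal (f x)))"
    by (subst null_sets_density_iff) auto
  then show "isCont F t"
    unfolding F[symmetric] isCont_cdf by (simp add: null_sets_def measure_def)
  show "mono F"
    unfolding F[symmetric] by (auto intro: monoI cdf_nondecreasing)
  show "0 \<le> F t" "F t \<le> 1" "(F \<longlongrightarrow> 1) at_top"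
    unfolding F[symmetric] by (auto simp: cdf_nonneg cdf_bounded_prob cdf_lim_at_top_prob)
  show "0 < F t \<and> F t < 1 \<longleftrightarrow> a < ereal t \<and> ereal t < b"
    using assms unfolding ac_cdf_on_def by blast
qed

section \<open>A differentiable version of the regression function\<close>

text \<open>Any version \<open>r\<close> agrees, almost everywhere for the law of
  \<open>X 1\<close>, with the expectation after freezing \<open>X 1\<close>, whose derivative is
  known. Positivity of the density turns this into Lebesgue almost everywhere on
  \<open>(a, b)\<close>.\<close>

lemma regression_function_order_statistic:
  fixes X :: "nat \<Rightarrow> 'a \<Rightarrow> real"
  assumes n: "2 \<le> n" and j: "1 \<le> j" "j \<le> n"
    and ac: "ac_cdf_on a b F" and iid: "iid_with_cdf M X F"
    and int: "integrable M (order_statistic X j n)"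
    and reg: "regression_function M (order_statistic X j n) (order_statistic X 1 1) r"
  obtains R where
    "\<And>z. (R has_real_derivative real (n - 1 choose (j - 1)) * (F z ^ (j - 1) * (1 - F z) ^ (n - j))) (at z)"
    "AE x in lborel. a < ereal x \<and> ereal x < b \<longrightarrow> r x = R x"
proof -
  interpret prob_space M
    using iid by (simp add: iid_with_cdf_def)
  have indep: "indep_vars (\<lambda>_. borel) X {1..}" and cdf_X: "\<And>i. 1 \<le> i \<Longrightarrow> cdf (distr M borel (X i)) = F"
    using iid by (auto simp: iid_with_cdf_def)
  have X[measurable]: "X i \<in> borel_measurable M" if "1 \<le> i" for i
    using indep that by (auto simp: indep_vars_def)
  have [measurable]: "r \<in> borel_measurable borel"
    using reg by (simp add: regression_function_def)
  define W where "W \<omega> = (\<lambda>k\<in>{2..n}. X k \<omega>)" for \<omega>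
  define S where "S = PiM {2..n} (\<lambda>_. borel :: real measure)"
  \<comment> \<open>The order statistic as a function of the pair formed by the first observation
    and the tuple of the others.\<close>
  define g where "g = order_statistic (\<lambda>i (p :: real \<times> (nat \<Rightarrow> real)). if i = 1 then fst p else snd p i) j n"
  define R where "R x = expectation (order_statistic (X(1 := \<lambda>_. x)) j n)" for x
  have [measurable]: "W \<in> measurable M S"
    unfolding W_def S_def by (intro measurable_restrict X) auto
  have [measurable]: "g \<in> borel_measurable (borel \<Otimes>\<^sub>M S)"
    unfolding g_def S_def
  proof (rule borel_measurable_order_statistic[OF j])
    fix i assume "i \<in> {1..n}"
    then show "(\<lambda>p. if i = 1 then fst p else snd p i) \<in>
        borel_measurable (borel \<Otimes>\<^sub>M PiM {2..n} (\<lambda>_. borel :: real measure))"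
      by (cases "i = 1") auto
  qed
  have g_X: "g (X 1 \<omega>, W \<omega>) = order_statistic X j n \<omega>" for \<omega>
    unfolding g_def by (rule order_statistic_cong) (auto simp: W_def)
  have g_W: "g (x, W \<omega>) = order_statistic (X(1 := \<lambda>_. x)) j n \<omega>" for x \<omega>
    unfolding g_def by (rule order_statistic_cong) (auto simp: W_def)
  have R_eq: "(\<integral>\<omega>. g (x, W \<omega>) \<partial>M) = R x" for x
    unfolding R_def g_W ..
  have "indep_vars (\<lambda>_. borel) X (insert 1 {2..n})"
    by (rule indep_vars_subset[OF indep]) auto
  then have joint: "distr M borel (X 1) \<Otimes>\<^sub>M distr M S W = distr M (borel \<Otimes>\<^sub>M S) (\<lambda>\<omega>. (X 1 \<omega>, W \<omega>))"
    unfolding W_def S_def by (rule distr_pair_indep_vars_insert) simp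
  note freeze = X[OF order_refl] \<open>W \<in> measurable M S\<close> joint \<open>g \<in> borel_measurable (borel \<Otimes>\<^sub>M S)\<close>
  have int_g: "integrable M (\<lambda>\<omega>. g (X 1 \<omega>, W \<omega>))"
    unfolding g_X by (rule int)
  interpret D: prob_space "distr M borel (X 1)"
    by (rule prob_space_distr) simp
  \<comment> \<open>A property that holds almost surely under a probability measure holds at some
    point, and one integrable frozen value is enough for the derivative.\<close>
  obtain x0 where "integrable M (order_statistic (X(1 := \<lambda>_. x0)) j n)"
    using eventually_happens'[OF D.ae_filter_bot AE_integrable_indep[OF freeze int_g]]
    unfolding g_W by blast
  then have deriv: "(R has_real_derivative real (n - 1 choose (j - 1)) * (F z ^ (j - 1) * (1 - F z) ^ (n - j))) (at z)" for z
    unfolding R_def using cdf_X ac_cdf_onD(1)[OF ac] indep_vars_subset[OF indep, of "{2..n}"]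
    by (intro has_real_derivative_expectation_order_statistic_upd[OF j n]) auto
  have [measurable]: "R \<in> borel_measurable borel"
    using borel_measurable_integral_indep[OF freeze int_g] unfolding R_eq .
  have "AE \<omega> in M. r (X 1 \<omega>) = R (X 1 \<omega>)"
    using real_cond_exp_indep[OF freeze int_g] reg
    unfolding g_X R_eq regression_function_def order_statistic_1_1 by auto
  then have ae: "AE x in distr M borel (X 1). r x = R x"
    by (subst AE_distr_iff) auto
  obtain f :: "real \<Rightarrow> real" where [measurable]: "f \<in> borel_measurable borel"
    and pos: "\<And>x. a < ereal x \<and> ereal x < b \<Longrightarrow> 0 < f x"
    and dens: "prob_space (density lborel (\<lambda>x. ennreal (f x)))"
    and F: "cdf (density lborel (\<lambda>x. ennreal (f x))) = F"
    using ac unfolding ac_cdf_on_def by blast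
  \<comment> \<open>The law of \<open>X 1\<close> is given only through its cdf; a cdf determines
    its distribution, so the law has the density \<open>f\<close>.\<close>
  have "distr M borel (X 1) = density lborel (\<lambda>x. ennreal (f x))"
    using dens cdf_X[of 1] F by (intro cdf_unique real_distribution_densityI real_distribution_distr) auto
  with ae have "AE x in density lborel (\<lambda>x. ennreal (f x)). r x = R x"
    by (simp only:)
  then have "AE x in lborel. 0 < ennreal (f x) \<longrightarrow> r x = R x"
    by (subst (asm) AE_density) auto
  then have "AE x in lborel. a < ereal x \<and> ereal x < b \<longrightarrow> r x = R x"
    by eventually_elim (auto simp: pos)
  with deriv that show thesis
    by blast
qed

section \<open>Comparison of two distribution functions with the same regression\<close>

text \<open>The hypotheses are split between \<open>F\<close> (continuity, limit 1) and
  \<open>G\<close> (monotonicity, bound 1) so that the lemma can also be applied with the two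
  exchanged.\<close>

lemma unimodal_crossing_impossible:
  fixes F G :: "real \<Rightarrow> real"
  assumes F: "\<And>t. isCont F t" "(F \<longlongrightarrow> 1) at_top" and G: "mono G" "\<And>t. G t \<le> 1"
    and eq: "\<And>t. 0 < F t \<Longrightarrow> F t < 1 \<Longrightarrow> F t ^ k * (1 - F t) ^ l = G t ^ k * (1 - G t) ^ l"
    and "0 < F x" and less: "real (k + l) * F x < k" "k < real (k + l) * G x"
  shows False
proof -
  define p where "p = real k / real (k + l)"
  have "k + l > 0"
    using less by (cases "k + l = 0") auto
  then have p_eq: "real (k + l) * p = k"
    by (simp add: p_def)
  have Fp: "F x < p" and pG: "p < G x"
    using less \<open>k + l > 0\<close> by (auto simp: p_def field_simps)
  have "p < 1"
    using pG G(2)[of x] by linarith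
  \<comment> \<open>Since \<open>p < 1\<close>, \<open>F\<close> eventually exceeds
    \<open>p\<close>, which supplies the right end for the intermediate value theorem.\<close>
  have "\<forall>\<^sub>F t in at_top. p < F t \<and> x \<le> t"
    using order_tendstoD(1)[OF F(2) \<open>p < 1\<close>] eventually_ge_at_top[of x] by eventually_elim auto
  then obtain t where "p < F t" "x \<le> t"
    using eventually_happens' trivial_limit_at_top_linorder by blast
  then obtain y where y: "x \<le> y" "F y = p"
    using IVT[of F x p t] F(1) Fp by auto
  have "p < G y"
    using monoD[OF G(1) y(1)] pG by linarith
  have "0 < l"
    using p_eq \<open>p < 1\<close> \<open>k + l > 0\<close> by (cases l) (auto simp: p_def)
  then have "G y ^ k * (1 - G y) ^ l < p ^ k * (1 - p) ^ l"
    using \<open>p < G y\<close> G(2) p_eq Fp \<open>0 < F x\<close> by (intro power_mult_power_strict_decreasing) auto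
  then show False
    using eq[of y] y(2) Fp \<open>0 < F x\<close> \<open>p < 1\<close> by simp
qed

theorem theorem3p10:
  fixes M :: "'a measure" and N :: "'b measure"
    and X :: "nat \<Rightarrow> 'a \<Rightarrow> real" and Y :: "nat \<Rightarrow> 'b \<Rightarrow> real"
    and F G r s :: "real \<Rightarrow> real"
    and a b :: ereal and n j :: nat
  assumes "n \<ge> 2" and "1 \<le> j" and "j \<le> n"
    and "a < b"
    and "ac_cdf_on a b F" and "ac_cdf_on a b G"
    and "iid_with_cdf M X F" and "iid_with_cdf N Y G"
    and "integrable M (order_statistic X j n)"
    and "integrable N (order_statistic Y j n)"
    and "regression_function M (order_statistic X j n) (order_statistic X 1 1) r"
    and "regression_function N (order_statistic Y j n) (order_statistic Y 1 1) s"
    and "AE x in lborel. a < ereal x \<and> ereal x < b \<longrightarrow> r x = s x"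
  shows "F = G"
proof
  fix x
  define k where "k = j - 1"
  define l where "l = n - j"
  define S where "S = {x. a < ereal x \<and> ereal x < b}"
  \<comment> \<open>Here \<open>k + l = n - 1\<close>, positive because \<open>n \<ge> 2\<close>;
    the binomial coefficient is nonzero because \<open>k \<le> n - 1\<close>, so it can be
    cancelled.\<close>
  have kl: "0 < k + l" "0 < n - 1 choose k"
    using assms(1-3) by (auto simp: k_def l_def)
  note F = ac_cdf_onD[OF assms(5)] and G = ac_cdf_onD[OF assms(6)]
  have S_F: "t \<in> S \<longleftrightarrow> 0 < F t \<and> F t < 1" and S_G: "t \<in> S \<longleftrightarrow> 0 < G t \<and> G t < 1" for t
    using F(6)[of t] G(6)[of t] by (auto simp: S_def)
  have "open S"
    unfolding S_def by (intro open_Collect_conj open_Collect_less continuous_intros)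
  obtain R where R: "\<And>z. (R has_real_derivative real (n - 1 choose k) * (F z ^ k * (1 - F z) ^ l)) (at z)"
    and r: "AE x in lborel. a < ereal x \<and> ereal x < b \<longrightarrow> r x = R x"
    using regression_function_order_statistic[OF assms(1-3,5,7,9,11)] unfolding k_def l_def by blast
  obtain Q where Q: "\<And>z. (Q has_real_derivative real (n - 1 choose k) * (G z ^ k * (1 - G z) ^ l)) (at z)"
    and s: "AE x in lborel. a < ereal x \<and> ereal x < b \<longrightarrow> s x = Q x"
    using regression_function_order_statistic[OF assms(1-3,6,8,10,12)] unfolding k_def l_def by blast
  have "AE x in lborel. x \<in> S \<longrightarrow> R x = Q x"
    using r s assms(13) by eventually_elim (auto simp: S_def)
  then have RQ: "R t = Q t" if "t \<in> S" for t
    using R Q that by (intro continuous_on_AE_lborel_eq[OF \<open>open S\<close>, of R Q])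
      (auto intro!: continuous_at_imp_continuous_on DERIV_isCont)
  have eq: "F t ^ k * (1 - F t) ^ l = G t ^ k * (1 - G t) ^ l" if "t \<in> S" for t
  proof -
    \<comment> \<open>\<open>Q\<close> coincides with \<open>R\<close> on the open set
      \<open>S\<close> and so inherits the derivative of \<open>R\<close> there; uniqueness of
      derivatives gives the equation.\<close>
    have "(Q has_real_derivative real (n - 1 choose k) * (F t ^ k * (1 - F t) ^ l)) (at t)"
      using R \<open>open S\<close> that RQ by (rule has_field_derivative_transform_within_open)
    from DERIV_unique[OF this Q] kl(2) show ?thesis
      by simp
  qed
  show "F x = G x"
  proof (cases "x \<in> S")
    case True
    \<comment> \<open>Excluding both strict crossings leaves \<open>F x\<close> and
      \<open>G x\<close> on a common side of the mode, where injectivity applies.\<close>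
    have "\<not> (real (k + l) * F x < k \<and> k < real (k + l) * G x)"
      using unimodal_crossing_impossible[OF F(1,5) G(2,4), of k l x] eq S_F True by blast
    moreover have "\<not> (real (k + l) * G x < k \<and> k < real (k + l) * F x)"
      using unimodal_crossing_impossible[OF G(1,5) F(2,4), of k l x] eq[symmetric] S_G True by blast
    ultimately show ?thesis
      using F(3,4) G(3,4) kl(1) by (intro power_mult_power_inj[OF eq[OF True]]) (auto simp: not_less)
  next
    case False
    obtain y where y: "y \<in> S"
      using ereal_dense2[OF \<open>a < b\<close>] by (auto simp: S_def)
    \<comment> \<open>Outside \<open>S\<close> the value is 0 or 1, and monotonicity decides which
      from the position of \<open>x\<close> relative to a point \<open>y\<close> where the value
      lies strictly between.\<close>
    have "H x = (if x < y then 0 else 1)"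
      if "mono H" "\<And>t. 0 \<le> H t" "\<And>t. H t \<le> 1" "\<And>t. t \<in> S \<longleftrightarrow> 0 < H t \<and> H t < 1" for H :: "real \<Rightarrow> real"
      using that(2,3)[of x] that(4)[of x] that(4)[of y] monoD[OF that(1), of x y] monoD[OF that(1), of y x] y False
      by auto
    from this[of F] this[of G] show ?thesis
      using F(2-4) G(2-4) S_F S_G by simp
  qed
qed

end
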